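(* For any vector of flow prices $\mathbf C=(C^1,\dots,C^{|\mathcal F|})$, there exists a unique set $\{\rho^f, f\in\mathcal F\}$ such that the symmetric strategy profile $\{r_j^f=\rho^f,\ j\in\mathcal R\}$ ($f\in\mathcal F$) is a Nash equilibrium of the followers' game with capacity limit $B$. Furthermore, there exist $\lambda\ge 0$ and $\{\nu^f=0, f\in\mathcal F\}$ such that $$(B_1)\quad g^f(\rho^f)=\lambda-\nu^f,\ \ \forall f\in\mathcal F,$$ $$(B_2)\quad \lambda\Big(\sum_{f\in\mathcal F}\rho^f-B\Big)=0,$$ $$(B_3)\quad \nu^f\rho^f=0,\ \ \forall f\in\mathcal F.$$
   Context: $\mathcal F$ is a set of flows and $\mathcal R$ a set of access points (APs) with $|\mathcal R|=R\ge 2$. Flow $f$ offers the payment (price) $C^f$. The cost of offloading a packet of flow $f$ is $e^f$, the same for all APs. In the followers' game with capacity limit $B$, the players are the APs; AP $i$ chooses $\mathbf r_i=(r_i^f)_{f\in\mathcal F}$ with $r_i^f\ge 0$ and $\sum_{f\in\mathcal F}r_i^f\le B$ to maximize its payoff $$V_i=\sum_{f\in\mathcal F}\Big[C^f\frac{r_i^f}{\sum_{j\in\mathcal R}r_j^f}-e^f r_i^f\Big].$$ The function $g^f$ is the marginal payoff at a symmetric profile: $$g^f(r^f)=\frac{\partial V_i}{\partial r_i^f}\Big|_{r_j^f=r^f\ \forall j\in\mathcal R}=C^f\frac{R-1}{R^2r^f}-e^f .$$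
   Formalization: All prices C^f and the capacity B are assumed positive; if C^f = 0 with e^f > 0, or if B = 0, the equilibrium has ρ^f = 0, where g^f is undefined and (B1) with ν^f = 0 cannot hold. *)

theory Defs
  imports "HOL-Analysis.Analysis"
begin

text \<open>
  The type \<^typ>\<open>'a\<close> is the finite set of access points, \<^typ>\<open>'f\<close> the finite set of flows.
  A strategy is a vector \<^typ>\<open>'f \<Rightarrow> real\<close>; a profile assigns a strategy to each access point.
\<close>

definition strategies :: "real \<Rightarrow> ('f::finite \<Rightarrow> real) set" where
  "strategies B = {s. (\<forall>f. 0 \<le> s f) \<and> (\<Sum>f\<in>UNIV. s f) \<le> B}"

text \<open>
  If no access point offloads flow \<open>f\<close>, the share of its price is \<open>0 / 0 = 0\<close>: nobody is paid
  for a flow that is not offloaded.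
\<close>

definition payoff ::
    "('f::finite \<Rightarrow> real) \<Rightarrow> ('f \<Rightarrow> real) \<Rightarrow> ('a::finite \<Rightarrow> 'f \<Rightarrow> real) \<Rightarrow> 'a \<Rightarrow> real" where
  "payoff C e r i = (\<Sum>f\<in>UNIV. C f * (r i f / (\<Sum>j\<in>UNIV. r j f)) - e f * r i f)"

definition nash_equilibrium ::
    "('f::finite \<Rightarrow> real) \<Rightarrow> ('f \<Rightarrow> real) \<Rightarrow> real \<Rightarrow> ('a::finite \<Rightarrow> 'f \<Rightarrow> real) \<Rightarrow> bool" where
  "nash_equilibrium C e B r \<longleftrightarrow>
     (\<forall>i. r i \<in> strategies B \<and>
          (\<forall>s\<in>strategies B. payoff C e (r(i := s)) i \<le> payoff C e r i))"

definition symmetric_profile :: "('f \<Rightarrow> real) \<Rightarrow> 'a \<Rightarrow> 'f \<Rightarrow> real" where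
  "symmetric_profile \<rho> = (\<lambda>j. \<rho>)"

text \<open>
  The partial derivative of the payoff of \<open>i\<close> with respect to its own rate for flow \<open>f\<close>, at the
  symmetric profile given by \<open>\<rho>\<close>. As shown below, for \<open>\<rho> f > 0\<close> it depends neither on
  \<open>i\<close> nor on the rates of the other flows. For \<open>\<rho> f = 0\<close> the derivative does not exist when
  \<open>C f \<noteq> 0\<close>, and the value is meaningless.
\<close>

definition marginal_payoff ::
    "('f::finite \<Rightarrow> real) \<Rightarrow> ('f \<Rightarrow> real) \<Rightarrow> 'a::finite \<Rightarrow> 'f \<Rightarrow> ('f \<Rightarrow> real) \<Rightarrow> real" where
  "marginal_payoff C e i f \<rho> =
     deriv (\<lambda>t. payoff C e ((symmetric_profile \<rho>)(i := \<rho>(f := t))) i) (\<rho> f)"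

lemma payoff_has_derivative_symmetric:
  fixes C e \<rho> :: "'f::finite \<Rightarrow> real" and i :: "'a::finite"
  assumes "\<rho> f > 0"
  shows "((\<lambda>t. payoff C e ((symmetric_profile \<rho>)(i := \<rho>(f := t))) i) has_real_derivative
            C f * (real CARD('a) - 1) / (real CARD('a) ^ 2 * \<rho> f) - e f) (at (\<rho> f))"
proof -
  let ?n = "real CARD('a)"
  define c where
    "c = (\<Sum>h\<in>UNIV - {f}. C h * (\<rho> h / (\<Sum>j\<in>(UNIV::'a set). \<rho> h)) - e h * \<rho> h)"
  have n: "?n > 0" by simp
  have S: "(\<Sum>j\<in>UNIV. ((symmetric_profile \<rho>)(i := \<rho>(f := t))) j f) = t + (?n - 1) * \<rho> f" for t
  proof -
    have "(\<Sum>j\<in>UNIV. ((symmetric_profile \<rho>)(i := \<rho>(f := t))) j f)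
        = t + (\<Sum>j\<in>UNIV - {i}. \<rho> f)"
      by (subst sum.remove[of _ i]) (auto simp: symmetric_profile_def)
    also have "(\<Sum>j\<in>UNIV - {i}. \<rho> f) = (?n - 1) * \<rho> f"
      by (simp add: card_Diff_singleton of_nat_diff Suc_leI)
    finally show ?thesis .
  qed
  have T: "(\<Sum>j\<in>UNIV. ((symmetric_profile \<rho>)(i := \<rho>(f := t))) j h) = (\<Sum>j\<in>(UNIV::'a set). \<rho> h)"
    if "h \<noteq> f" for h t
    using that by (intro sum.cong) (auto simp: symmetric_profile_def)
  have eq: "payoff C e ((symmetric_profile \<rho>)(i := \<rho>(f := t))) i
      = C f * (t / (t + (?n - 1) * \<rho> f)) - e f * t + c" for t
  proof -
    let ?r = "(symmetric_profile \<rho> :: 'a \<Rightarrow> 'f \<Rightarrow> real)(i := \<rho>(f := t))"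
    have rest: "(\<Sum>h\<in>UNIV - {f}. C h * (?r i h / (\<Sum>j\<in>UNIV. ?r j h)) - e h * ?r i h) = c"
      unfolding c_def
    proof (rule sum.cong[OF refl])
      fix h assume "h \<in> UNIV - {f}"
      then have h: "h \<noteq> f" by simp
      show "C h * (?r i h / (\<Sum>j\<in>UNIV. ?r j h)) - e h * ?r i h =
          C h * (\<rho> h / (\<Sum>j\<in>(UNIV::'a set). \<rho> h)) - e h * \<rho> h"
        unfolding T[OF h] using h by simp
    qed
    have "payoff C e ?r i = (C f * (?r i f / (\<Sum>j\<in>UNIV. ?r j f)) - e f * ?r i f) + c"
      unfolding payoff_def rest[symmetric] by (rule sum.remove) auto
    then show ?thesis unfolding S by simp
  qed
  have pos: "\<rho> f + (?n - 1) * \<rho> f = ?n * \<rho> f" by (simp add: algebra_simps)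
  show ?thesis
    unfolding eq
    using assms n
    by (auto intro!: derivative_eq_intros simp: pos) (simp add: field_simps power2_eq_square)
qed

corollary marginal_payoff_eq:
  fixes C e \<rho> :: "'f::finite \<Rightarrow> real" and i :: "'a::finite"
  assumes "\<rho> f > 0"
  shows "marginal_payoff C e i f \<rho> =
           C f * (real CARD('a) - 1) / (real CARD('a) ^ 2 * \<rho> f) - e f"
  unfolding marginal_payoff_def
  by (rule DERIV_imp_deriv[OF payoff_has_derivative_symmetric[where \<rho> = \<rho> and f = f, OF assms]])

end

theory Submission
  imports Defs
begin

text \<open>
  The payoff of an access point is concave in its own strategy and differentiable at positive
  rates. A symmetric equilibrium has positive rates only, because an arbitrarily small rate on an
  otherwise unserved flow earns its full price. Hence \<open>\<rho>\<close> is a symmetric equilibrium iff it is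
  positive, feasible and satisfies the variational inequality
  \<open>(\<Sum>f. g f (\<rho> f) * (s f - \<rho> f)) \<le> 0\<close> for all feasible \<open>s\<close>. The functions
  \<open>g f\<close> are strictly decreasing, which gives uniqueness; testing with suitable \<open>s\<close> gives
  the multiplier \<open>l\<close>. For existence, \<open>g f (\<rho> f) = l\<close> is solved by
  \<open>\<rho> f = K f / (l + e f)\<close>, and \<open>l\<close> is found by the intermediate value theorem.
\<close>

section \<open>Reduction to the response problem of one player\<close>

text \<open>The payoff of playing \<open>s\<close> against \<open>m\<close> opponents who play \<open>\<rho>\<close>.\<close>

definition response_payoff ::
    "real \<Rightarrow> ('f::finite \<Rightarrow> real) \<Rightarrow> ('f \<Rightarrow> real) \<Rightarrow> ('f \<Rightarrow> real) \<Rightarrow> ('f \<Rightarrow> real) \<Rightarrow> real" where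
  "response_payoff m C e \<rho> s = (\<Sum>f\<in>UNIV. C f * (s f / (s f + m * \<rho> f)) - e f * s f)"

text \<open>With \<open>m = R - 1\<close> opponents, \<open>m / (m + 1)\<^sup>2\<close> is (R -
  1)/R^2, so this is g^f at the rate \<open>\<rho> f\<close>.\<close>

definition symmetric_marginal ::
    "real \<Rightarrow> ('f \<Rightarrow> real) \<Rightarrow> ('f \<Rightarrow> real) \<Rightarrow> ('f \<Rightarrow> real) \<Rightarrow> 'f \<Rightarrow> real" where
  "symmetric_marginal m C e \<rho> f = C f * m / ((m + 1)\<^sup>2 * \<rho> f) - e f"

text \<open>First-order optimality of \<open>\<rho>\<close> against itself. Positivity is included
  because the formula for the marginal represents a derivative of the payoff only at positive
  rates.\<close>

definition variational_solution ::
    "real \<Rightarrow> ('f::finite \<Rightarrow> real) \<Rightarrow> ('f \<Rightarrow> real) \<Rightarrow> real \<Rightarrow> ('f \<Rightarrow> real) \<Rightarrow> bool" where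
  "variational_solution m C e B \<rho> \<longleftrightarrow> \<rho> \<in> strategies B \<and> (\<forall>f. \<rho> f > 0) \<and>
     (\<forall>s\<in>strategies B. (\<Sum>f\<in>UNIV. symmetric_marginal m C e \<rho> f * (s f - \<rho> f)) \<le> 0)"

lemma payoff_deviation:
  fixes C e \<rho> s :: "'f::finite \<Rightarrow> real" and i :: "'a::finite"
  shows "payoff C e ((symmetric_profile \<rho>)(i := s)) i
       = response_payoff (real CARD('a) - 1) C e \<rho> s"
proof -
  have "(\<Sum>j\<in>UNIV. ((symmetric_profile \<rho>)(i := s)) j f) = s f + (real CARD('a) - 1) * \<rho> f" for f
  proof -
    have "(\<Sum>j\<in>UNIV. ((symmetric_profile \<rho>)(i := s)) j f) = s f + (\<Sum>j\<in>UNIV - {i}. \<rho> f)"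
      by (subst sum.remove[of _ i]) (auto simp: symmetric_profile_def)
    also have "(\<Sum>j\<in>UNIV - {i}. \<rho> f) = (real CARD('a) - 1) * \<rho> f"
      by (simp add: card_Diff_singleton of_nat_diff Suc_leI)
    finally show ?thesis .
  qed
  then show ?thesis
    by (simp add: payoff_def response_payoff_def)
qed

lemma nash_equilibrium_symmetric_iff:
  fixes C e \<rho> :: "'f::finite \<Rightarrow> real"
  shows "nash_equilibrium C e B (symmetric_profile \<rho> :: 'a::finite \<Rightarrow> 'f \<Rightarrow> real) \<longleftrightarrow>
    \<rho> \<in> strategies B \<and>
    (\<forall>s\<in>strategies B. response_payoff (real CARD('a) - 1) C e \<rho> s
        \<le> response_payoff (real CARD('a) - 1) C e \<rho> \<rho>)"
proof -
  have "payoff C e (symmetric_profile \<rho>) i = response_payoff (real CARD('a) - 1) C e \<rho> \<rho>"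
    for i :: 'a
  proof -
    have "(symmetric_profile \<rho>)(i := \<rho>) = (symmetric_profile \<rho> :: 'a \<Rightarrow> 'f \<Rightarrow> real)"
      by (auto simp: symmetric_profile_def)
    then show ?thesis
      using payoff_deviation[of C e \<rho> i \<rho>] by simp
  qed
  then show ?thesis
    by (simp add: nash_equilibrium_def payoff_deviation) (simp add: symmetric_profile_def)
qed

lemma strategies_segment:
  assumes "\<rho> \<in> strategies B" "s \<in> strategies B" "0 \<le> t" "t \<le> 1"
  shows "(\<lambda>f. \<rho> f + t * (s f - \<rho> f)) \<in> strategies B"
proof -
  have "0 \<le> \<rho> f + t * (s f - \<rho> f)" for f
  proof -
    have "0 \<le> (1 - t) * \<rho> f + t * s f"
      using assms by (auto simp: strategies_def)
    then show ?thesis by (simp add: algebra_simps)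
  qed
  moreover have "(\<Sum>f\<in>UNIV. \<rho> f + t * (s f - \<rho> f)) \<le> B"
  proof -
    have "(\<Sum>f\<in>UNIV. \<rho> f + t * (s f - \<rho> f)) = (1 - t) * sum \<rho> UNIV + t * sum s UNIV"
      by (simp add: sum.distrib sum_distrib_left[symmetric] sum_subtractf algebra_simps)
    also have "\<dots> \<le> (1 - t) * B + t * B"
      using assms by (intro add_mono mult_left_mono) (auto simp: strategies_def)
    finally show ?thesis by (simp add: algebra_simps)
  qed
  ultimately show ?thesis by (simp add: strategies_def)
qed

section \<open>Positivity of equilibrium rates\<close>

lemma point_strategy: "B \<ge> 0 \<Longrightarrow> (\<lambda>h. if h = f then B else 0) \<in> strategies B"
  by (auto simp: strategies_def)

text \<open>Moving a fraction \<open>t\<close> of the way from \<open>\<rho>\<close> to the vertex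
  that spends all of \<open>B\<close> on \<open>f\<close> is feasible even if \<open>\<rho>\<close>
  exhausts the capacity. If \<open>\<rho> f = 0\<close>, the share of \<open>f\<close> jumps from 0
  to 1 while the other summands vary continuously, so for small \<open>t\<close> the payoff gains
  almost \<open>C f\<close>.\<close>

lemma best_response_pos:
  fixes C e \<rho> :: "'f::finite \<Rightarrow> real"
  assumes m: "m > 0" and C: "C f > 0" and B: "B > 0"
    and \<rho>: "\<rho> \<in> strategies B"
    and best: "\<And>s. s \<in> strategies B \<Longrightarrow> response_payoff m C e \<rho> s \<le> response_payoff m C e \<rho> \<rho>"
  shows "\<rho> f > 0"
proof (rule ccontr)
  assume "\<not> \<rho> f > 0"
  then have \<rho>f: "\<rho> f = 0" using \<rho> by (auto simp: strategies_def intro: antisym)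
  define s where "s = (\<lambda>t h. \<rho> h + t * ((if h = f then B else 0) - \<rho> h))"
  \<comment> \<open>The jump of summand \<open>h\<close> at \<open>t = 0\<close>.\<close>
  define c where "c h = (if h = f then C f else 0)" for h
  have lim: "((\<lambda>t. C h * (s t h / (s t h + m * \<rho> h)) - e h * s t h) \<longlongrightarrow>
      C h * (\<rho> h / (\<rho> h + m * \<rho> h)) - e h * \<rho> h + c h) (at_right 0)" for h
  proof (cases "h = f")
    case True
    have "((\<lambda>t. C f - e f * (t * B)) \<longlongrightarrow> C f - e f * (0 * B)) (at_right 0)"
      by (intro tendsto_intros)
    \<comment> \<open>For \<open>t > 0\<close> the share of \<open>f\<close> is
      \<open>t * B / (t * B) = 1\<close>.\<close>
    moreover have "\<forall>\<^sub>F t in at_right 0. C f - e f * (t * B)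
        = C h * (s t h / (s t h + m * \<rho> h)) - e h * s t h"
      unfolding eventually_at_right_field
      by (rule exI[of _ 1]) (use True \<rho>f B in \<open>auto simp: s_def\<close>)
    ultimately show ?thesis
      using True \<rho>f by (simp add: c_def tendsto_cong)
  next
    case False
    show ?thesis
    proof (cases "\<rho> h = 0")
      case True
      \<comment> \<open>Here \<open>s t h = 0\<close> for all \<open>t\<close>, so the share stays
        at \<open>0 / 0 = 0\<close> and the summand is constant.\<close>
      then show ?thesis using False by (simp add: s_def c_def)
    next
      case h: False
      have lims: "((\<lambda>t. s t h) \<longlongrightarrow> \<rho> h + 0 * (0 - \<rho> h)) (at_right 0)"
      proof -
        have "((\<lambda>t. \<rho> h + t * (0 - \<rho> h)) \<longlongrightarrow> \<rho> h + 0 * (0 - \<rho> h)) (at_right 0)"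
          by (intro tendsto_intros)
        then show ?thesis using False by (simp add: s_def)
      qed
      have "\<rho> h > 0" using h \<rho> by (auto simp: strategies_def less_le)
      then have "\<rho> h + m * \<rho> h \<noteq> 0" using m by (simp add: add_pos_pos less_imp_neq[symmetric])
      then show ?thesis
        using False lims by (auto simp: c_def intro!: tendsto_intros)
    qed
  qed
  have "((\<lambda>t. response_payoff m C e \<rho> (s t)) \<longlongrightarrow> response_payoff m C e \<rho> \<rho> + sum c UNIV) (at_right 0)"
    unfolding response_payoff_def sum.distrib[symmetric] by (intro tendsto_sum lim)
  then have "((\<lambda>t. response_payoff m C e \<rho> (s t)) \<longlongrightarrow> response_payoff m C e \<rho> \<rho> + C f) (at_right 0)"
    by (simp add: c_def)
  moreover have "\<forall>\<^sub>F t in at_right 0. response_payoff m C e \<rho> (s t) \<le> response_payoff m C e \<rho> \<rho>"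
    unfolding eventually_at_right_field
    by (rule exI[of _ 1]) (use B in \<open>auto simp: s_def intro!: best strategies_segment \<rho> point_strategy\<close>)
  ultimately have "response_payoff m C e \<rho> \<rho> + C f \<le> response_payoff m C e \<rho> \<rho>"
    by (intro tendsto_upperbound) auto
  then show False using C by simp
qed

section \<open>Best responses and the variational inequality\<close>

lemma response_payoff_has_derivative_segment:
  fixes C e \<rho> s :: "'f::finite \<Rightarrow> real"
  assumes m: "m > 0" and pos: "\<And>f. \<rho> f > 0"
  shows "((\<lambda>t. response_payoff m C e \<rho> (\<lambda>f. \<rho> f + t * (s f - \<rho> f))) has_real_derivative
      (\<Sum>f\<in>UNIV. symmetric_marginal m C e \<rho> f * (s f - \<rho> f))) (at 0)"
  unfolding response_payoff_def
proof (rule DERIV_sum)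
  fix f
  have "((\<lambda>x. C f * (x / (x + m * \<rho> f)) - e f * x) has_real_derivative
      symmetric_marginal m C e \<rho> f) (at (\<rho> f))"
  proof -
    have nz: "\<rho> f + m * \<rho> f \<noteq> 0" using pos[of f] m by (simp add: add_pos_pos less_imp_neq[symmetric])
    have "((\<lambda>x. C f * (x / (x + m * \<rho> f)) - e f * x) has_real_derivative
        C f * (m * \<rho> f / ((\<rho> f + m * \<rho> f) * (\<rho> f + m * \<rho> f))) - e f) (at (\<rho> f))"
      using nz by (auto intro!: derivative_eq_intros simp: distrib_left)
    also have "\<rho> f + m * \<rho> f = (m + 1) * \<rho> f" by (simp add: algebra_simps)
    also have "C f * (m * \<rho> f / ((m + 1) * \<rho> f * ((m + 1) * \<rho> f))) - e f = symmetric_marginal m C e \<rho> f"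
      using pos[of f] by (simp add: symmetric_marginal_def power2_eq_square mult.assoc mult.left_commute)
    finally show ?thesis .
  qed
  then have "((\<lambda>x. C f * (x / (x + m * \<rho> f)) - e f * x) has_real_derivative
      symmetric_marginal m C e \<rho> f) (at (\<rho> f + 0 * (s f - \<rho> f)))" by simp
  moreover have "((\<lambda>t. \<rho> f + t * (s f - \<rho> f)) has_real_derivative (s f - \<rho> f)) (at 0)"
    by (auto intro!: derivative_eq_intros)
  ultimately show "((\<lambda>t. C f * ((\<rho> f + t * (s f - \<rho> f)) / (\<rho> f + t * (s f - \<rho> f) + m * \<rho> f))
      - e f * (\<rho> f + t * (s f - \<rho> f))) has_real_derivative
      symmetric_marginal m C e \<rho> f * (s f - \<rho> f)) (at 0)"
    by (rule DERIV_chain2)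
qed

text \<open>The share is concave in \<open>x\<close>, and its distance below the tangent at
  \<open>r\<close> is an explicit multiple of \<open>(x - r)\<^sup>2\<close>.\<close>

lemma share_le_tangent:
  fixes m r x :: real
  assumes "m > 0" "r > 0" "x \<ge> 0"
  shows "x / (x + m * r) \<le> r / (r + m * r) + m / ((m + 1)\<^sup>2 * r) * (x - r)"
proof -
  define n p where "n = m + 1" and "p = x + m * r"
  have pos: "n > 0" "p > 0" using assms by (auto simp: n_def p_def intro: add_nonneg_pos)
  \<comment> \<open>With the denominators \<open>n\<close> and \<open>p\<close> as variables,
    clearing fractions leaves a polynomial identity.\<close>
  have m: "m = n - 1" and x: "x = p - (n - 1) * r" by (simp_all add: n_def p_def)
  have "r + m * r = n * r" by (simp add: n_def algebra_simps)
  then have "r / (r + m * r) + m / (n\<^sup>2 * r) * (x - r) - x / p = m * (x - r)\<^sup>2 / (n\<^sup>2 * r * p)"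
    using assms(2) pos unfolding m x
    by (simp add: divide_simps power2_eq_square) (simp add: algebra_simps)
  also have "\<dots> \<ge> 0" using assms pos by auto
  finally show ?thesis by (simp add: n_def p_def)
qed

text \<open>Forward: a positive derivative along a feasible segment would make a small step
  profitable. Backward: the tangent bound holds for all \<open>s f \<ge> 0\<close>, so first-order
  optimality is already global.\<close>

lemma best_response_iff_variational_solution:
  fixes C e \<rho> :: "'f::finite \<Rightarrow> real"
  assumes m: "m > 0" and C: "\<And>f. C f > 0" and B: "B > 0"
  shows "(\<rho> \<in> strategies B \<and>
      (\<forall>s\<in>strategies B. response_payoff m C e \<rho> s \<le> response_payoff m C e \<rho> \<rho>))
    \<longleftrightarrow> variational_solution m C e B \<rho>" (is "?L \<longleftrightarrow> ?R")
proof
  assume L: ?L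
  then have \<rho>: "\<rho> \<in> strategies B"
    and best: "\<And>s. s \<in> strategies B \<Longrightarrow> response_payoff m C e \<rho> s \<le> response_payoff m C e \<rho> \<rho>"
    by auto
  have pos: "\<rho> f > 0" for f using best_response_pos[OF m C B \<rho> best] .
  have "(\<Sum>f\<in>UNIV. symmetric_marginal m C e \<rho> f * (s f - \<rho> f)) \<le> 0" if s: "s \<in> strategies B" for s
  proof (rule ccontr)
    assume "\<not> ?thesis"
    then obtain d where d: "d > 0"
      and inc: "\<And>t. 0 < t \<Longrightarrow> t < d \<Longrightarrow> response_payoff m C e \<rho> \<rho>
          < response_payoff m C e \<rho> (\<lambda>f. \<rho> f + t * (s f - \<rho> f))"
      using DERIV_pos_inc_right[OF response_payoff_has_derivative_segment
          [where \<rho> = \<rho> and C = C and e = e and s = s, OF m pos]]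
      by auto
    \<comment> \<open>Small enough both to stay on the segment and to lie strictly below
      \<open>d\<close>.\<close>
    define t where "t = min 1 (d / 2)"
    have t: "0 < t" "t < d" "t \<le> 1" using d by (auto simp: t_def)
    show False
      using inc[OF t(1,2)] best[OF strategies_segment[OF \<rho> s, of t]] t by simp
  qed
  then show ?R using \<rho> pos by (simp add: variational_solution_def)
next
  assume R: ?R
  then have pos: "\<And>f. \<rho> f > 0" by (simp add: variational_solution_def)
  have "response_payoff m C e \<rho> s \<le> response_payoff m C e \<rho> \<rho>" if s: "s \<in> strategies B" for s
  proof -
    have "C f * (s f / (s f + m * \<rho> f)) - e f * s f
        \<le> (C f * (\<rho> f / (\<rho> f + m * \<rho> f)) - e f * \<rho> f)
          + symmetric_marginal m C e \<rho> f * (s f - \<rho> f)" for f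
    proof -
      have "s f \<ge> 0" using s by (simp add: strategies_def)
      from mult_left_mono[OF share_le_tangent[OF m pos this], of "C f"] C[of f]
      show ?thesis by (simp add: symmetric_marginal_def algebra_simps)
    qed
    then have "response_payoff m C e \<rho> s \<le> response_payoff m C e \<rho> \<rho>
        + (\<Sum>f\<in>UNIV. symmetric_marginal m C e \<rho> f * (s f - \<rho> f))"
      unfolding response_payoff_def sum.distrib[symmetric] by (intro sum_mono)
    moreover have "(\<Sum>f\<in>UNIV. symmetric_marginal m C e \<rho> f * (s f - \<rho> f)) \<le> 0"
      using R s by (simp add: variational_solution_def)
    ultimately show ?thesis by linarith
  qed
  then show ?L using R by (simp add: variational_solution_def)
qed

section \<open>Uniqueness\<close>

text \<open>Testing each solution with the other and adding the two inequalities bounds a sum of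
  nonnegative terms by 0.\<close>

lemma variational_solution_unique:
  fixes C e \<rho> \<sigma> :: "'f::finite \<Rightarrow> real"
  assumes m: "m > 0" and C: "\<And>f. C f > 0"
    and \<rho>: "variational_solution m C e B \<rho>" and \<sigma>: "variational_solution m C e B \<sigma>"
  shows "\<rho> = \<sigma>"
proof
  fix h
  \<comment> \<open>The sum of the two tested terms for flow \<open>f\<close>: the costs cancel, and
    the difference of the reciprocals of \<open>\<rho> f\<close> and \<open>\<sigma> f\<close>
    yields the square.\<close>
  define D where "D f = C f * m / (m + 1)\<^sup>2 * (\<sigma> f - \<rho> f)\<^sup>2 / (\<rho> f * \<sigma> f)" for f
  have pos: "\<rho> f > 0" "\<sigma> f > 0" for f using \<rho> \<sigma> by (auto simp: variational_solution_def)
  have D: "D f = symmetric_marginal m C e \<rho> f * (\<sigma> f - \<rho> f)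
      + symmetric_marginal m C e \<sigma> f * (\<rho> f - \<sigma> f)" for f
  proof -
    have "m + 1 \<noteq> 0" using m by simp
    then show ?thesis
      using pos[of f]
      by (simp add: D_def symmetric_marginal_def divide_simps)
        (simp add: algebra_simps power2_eq_square)
  qed
  have nonneg: "D f \<ge> 0" for f
    using pos[of f] C[of f] m by (simp add: D_def)
  have "sum D UNIV \<le> 0"
    unfolding D sum.distrib using \<rho> \<sigma> by (simp add: variational_solution_def add_nonpos_nonpos)
  then have "D h = 0"
    using sum_nonneg_eq_0_iff[of UNIV D] nonneg sum_nonneg[of UNIV D] by force
  then show "\<rho> h = \<sigma> h"
    using pos[of h] C[of h] m by (auto simp: D_def)
qed

section \<open>The capacity multiplier\<close>

text \<open>Positive rates can be shifted between any two flows, which forces equal marginals. Their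
  common value is the multiplier; the zero strategy gives its sign, and a strategy that exhausts
  \<open>B\<close> gives complementarity.\<close>

lemma variational_solution_multiplier:
  fixes C e \<rho> :: "'f::finite \<Rightarrow> real"
  assumes B: "B > 0" and \<rho>: "variational_solution m C e B \<rho>"
  obtains l where "l \<ge> 0" "\<forall>f. symmetric_marginal m C e \<rho> f = l" "l * (sum \<rho> UNIV - B) = 0"
proof -
  let ?g = "symmetric_marginal m C e \<rho>"
  have pos: "\<And>f. \<rho> f > 0" and le: "sum \<rho> UNIV \<le> B"
    and var: "\<And>s. s \<in> strategies B \<Longrightarrow> (\<Sum>f\<in>UNIV. ?g f * (s f - \<rho> f)) \<le> 0"
    using \<rho> by (auto simp: variational_solution_def strategies_def)
  have g_le: "?g f \<le> ?g h" for f h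
  proof (cases "f = h")
    case False
    \<comment> \<open>Moves the whole rate of \<open>h\<close> to \<open>f\<close>; the total is
      unchanged, so no spare capacity is required.\<close>
    define \<delta> where "\<delta> k = (if k = f then \<rho> h else 0) - (if k = h then \<rho> h else 0)" for k
    have "(\<lambda>k. \<rho> k + \<delta> k) \<in> strategies B"
      using le pos False
      by (auto simp: strategies_def \<delta>_def sum.distrib sum_subtractf less_imp_le add_nonneg_nonneg)
    from var[OF this] have "(\<Sum>k\<in>UNIV. ?g k * \<delta> k) \<le> 0" by simp
    also have "(\<Sum>k\<in>UNIV. ?g k * \<delta> k) = (\<Sum>k\<in>UNIV. (if k = f then ?g f * \<rho> h else 0)
        - (if k = h then ?g h * \<rho> h else 0))"
      by (rule sum.cong) (auto simp: \<delta>_def algebra_simps)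
    also have "\<dots> = (?g f - ?g h) * \<rho> h" by (simp add: sum_subtractf algebra_simps)
    finally show ?thesis using pos[of h] by (simp add: mult_le_0_iff)
  qed simp
  \<comment> \<open>All marginals agree, so an arbitrary flow names the common value.\<close>
  define l where "l = ?g undefined"
  have gl: "?g f = l" for f unfolding l_def by (intro antisym g_le)
  have varl: "l * (sum s UNIV - sum \<rho> UNIV) \<le> 0" if "s \<in> strategies B" for s :: "'f \<Rightarrow> real"
    using var[OF that] by (simp add: gl sum_distrib_left[symmetric] sum_subtractf)
  have "sum \<rho> UNIV > 0" using pos by (intro sum_pos) auto
  then have l: "l \<ge> 0"
    using varl[of "\<lambda>f. 0"] B by (simp add: strategies_def zero_le_mult_iff)
  have "l * (B - sum \<rho> UNIV) \<le> 0"
    using varl[OF point_strategy[of B undefined]] B by simp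
  moreover have "l * (B - sum \<rho> UNIV) \<ge> 0" using l le by simp
  ultimately have "l * (sum \<rho> UNIV - B) = 0" by (simp add: algebra_simps)
  with l gl show thesis by (intro that) auto
qed

section \<open>Existence by water filling\<close>

text \<open>If the demand at level 0 is well defined and fits into \<open>B\<close>, then
  \<open>l = 0\<close>; otherwise some level makes the demand equal to \<open>B\<close>. Since
  \<open>e f\<close> may be zero or negative, the search stays to the right of all poles
  \<open>- e f\<close>, the largest of which is \<open>L\<close>.\<close>

lemma water_filling_level_exists:
  fixes K e :: "'f::finite \<Rightarrow> real"
  assumes K: "\<And>f. K f > 0" and B: "B > 0"
  obtains l where "l \<ge> 0" "\<forall>f. l + e f > 0" "(\<Sum>f\<in>UNIV. K f / (l + e f)) \<le> B"
    "l * ((\<Sum>f\<in>UNIV. K f / (l + e f)) - B) = 0"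
proof (cases "(\<forall>f. e f > 0) \<and> (\<Sum>f\<in>UNIV. K f / e f) \<le> B")
  case True
  then show thesis by (intro that[of 0]) auto
next
  case False
  define S where "S l = (\<Sum>f\<in>UNIV. K f / (l + e f))" for l
  define L where "L = Max (range (\<lambda>f. - e f))"
  have L: "- e f \<le> L" for f unfolding L_def by (rule Max_ge) auto
  have "L \<in> range (\<lambda>f. - e f)" unfolding L_def by (rule Max_in) auto
  then obtain h where h: "L = - e h" by auto
  \<comment> \<open>At this level every denominator is at least \<open>sum K UNIV / B\<close>, which
    pushes the total down to at most \<open>B\<close>. The \<open>max\<close> keeps
    \<open>l2\<close> above both candidates for the lower end.\<close>
  define l2 where "l2 = max 0 L + sum K UNIV / B"
  have sumK: "sum K UNIV > 0" using K by (intro sum_pos) auto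
  have l2: "S l2 \<le> B"
  proof -
    have "S l2 \<le> (\<Sum>f\<in>UNIV. K f / (sum K UNIV / B))"
      unfolding S_def
    proof (intro sum_mono divide_left_mono)
      fix f
      show *: "sum K UNIV / B \<le> l2 + e f" using L[of f] by (auto simp: l2_def)
      have "sum K UNIV / B > 0" using sumK B by simp
      then show "0 < (l2 + e f) * (sum K UNIV / B)" using * by (intro mult_pos_pos) auto
    qed (use K in \<open>auto intro: less_imp_le\<close>)
    also have "\<dots> = B" using sumK by (simp add: sum_divide_distrib[symmetric] sum_distrib_right[symmetric])
    finally show ?thesis .
  qed
  obtain l1 where l1: "0 \<le> l1" "L < l1" "l1 \<le> l2" "B \<le> S l1"
  proof (cases "\<forall>f. e f > 0")
    case True
    \<comment> \<open>With all costs positive, the failed case condition can only mean excess demand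
      at level 0, so \<open>l1 = 0\<close> serves.\<close>
    then have "S 0 > B" using False by (auto simp: S_def)
    moreover have "L < 0" using h True by auto
    ultimately show thesis
      using that[of 0] sumK B by (auto simp: l2_def)
  next
    case e: False
    then have L0: "L \<ge> 0" using L by (meson linorder_not_less neg_0_le_iff_le order_trans)
    \<comment> \<open>Chosen so that the summand of \<open>h\<close>, whose pole is
      \<open>L\<close>, equals \<open>B\<close> by itself.\<close>
    define l1 where "l1 = L + K h / B"
    have l1L: "L < l1" using K B by (simp add: l1_def)
    have "K h \<le> sum K UNIV"
      by (rule member_le_sum) (use K in \<open>auto intro: less_imp_le\<close>)
    then have "l1 \<le> l2" using L0 B by (simp add: l1_def l2_def divide_right_mono)
    moreover have "B \<le> S l1"
    proof -
      have "B = K h / (l1 + e h)" using K[of h] B by (simp add: l1_def h)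
      also have "\<dots> \<le> S l1" unfolding S_def
      proof (rule member_le_sum)
        fix f
        have "l1 + e f > 0" using L[of f] l1L by simp
        then show "0 \<le> K f / (l1 + e f)" using K[of f] by simp
      qed auto
      finally show ?thesis .
    qed
    ultimately show thesis using that l1L L0 by auto
  qed
  have pos: "l + e f > 0" if "l1 \<le> l" for l f using L[of f] l1 that by simp
  have "continuous_on {l1..l2} S"
    unfolding S_def by (intro continuous_intros ballI) (use pos in \<open>force simp: less_le\<close>)
  then obtain l where l: "l1 \<le> l" "l \<le> l2" "S l = B"
    using IVT2'[of S l2 B l1] l1 l2 by auto
  then show thesis
    using that[of l] pos l1(1) by (auto simp: S_def)
qed

text \<open>At the water-filling rates all marginals equal \<open>l\<close>, so the variational sum
  depends only on total rates and complementarity settles its sign.\<close>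

lemma variational_solution_exists:
  fixes C e :: "'f::finite \<Rightarrow> real"
  assumes m: "m > 0" and C: "\<And>f. C f > 0" and B: "B > 0"
  shows "\<exists>\<rho>. variational_solution m C e B \<rho>"
proof -
  define K where "K f = C f * m / (m + 1)\<^sup>2" for f
  have K: "K f > 0" for f using C m by (simp add: K_def)
  obtain l where l: "l \<ge> 0" "\<forall>f. l + e f > 0" "(\<Sum>f\<in>UNIV. K f / (l + e f)) \<le> B"
    "l * ((\<Sum>f\<in>UNIV. K f / (l + e f)) - B) = 0"
    using water_filling_level_exists[where K = K and e = e, OF K B] by metis
  define \<rho> where "\<rho> f = K f / (l + e f)" for f
  have pos: "\<rho> f > 0" for f using K l(2) by (simp add: \<rho>_def)
  have le: "sum \<rho> UNIV \<le> B" and compl: "l * sum \<rho> UNIV = l * B"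
    using l(3,4) by (simp_all add: \<rho>_def right_diff_distrib)
  have "symmetric_marginal m C e \<rho> f = l" for f
  proof -
    have "symmetric_marginal m C e \<rho> f = K f / \<rho> f - e f"
      by (simp add: symmetric_marginal_def K_def)
    also have "\<dots> = l"
      using less_imp_neq[OF K[of f]] by (simp add: \<rho>_def)
    finally show ?thesis .
  qed
  then have "(\<Sum>f\<in>UNIV. symmetric_marginal m C e \<rho> f * (s f - \<rho> f)) = l * (sum s UNIV - sum \<rho> UNIV)" for s
    by (simp add: sum_distrib_left[symmetric] sum_subtractf)
  \<comment> \<open>By \<open>compl\<close>, \<open>l * sum \<rho> UNIV\<close> may be replaced by
    \<open>l * B\<close>, and \<open>s\<close> uses at most \<open>B\<close>.\<close>
  moreover have "l * (sum s UNIV - sum \<rho> UNIV) \<le> 0" if "s \<in> strategies B" for s :: "'f \<Rightarrow> real"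
  proof -
    have "l * sum s UNIV \<le> l * B"
      using that l(1) by (intro mult_left_mono) (auto simp: strategies_def)
    then show ?thesis by (simp add: right_diff_distrib compl)
  qed
  ultimately have "variational_solution m C e B \<rho>"
    using pos le by (simp add: variational_solution_def strategies_def less_imp_le)
  then show ?thesis by (rule exI[of _ \<rho>])
qed

section \<open>Equilibrium and multiplier conditions\<close>

theorem theorem5:
  fixes C e :: "'f::finite \<Rightarrow> real" and B :: real
  assumes "CARD('a::finite) \<ge> 2"
    and "\<And>f. C f > 0"
    and "B > 0"
  shows "(\<exists>!\<rho>. nash_equilibrium C e B (symmetric_profile \<rho> :: 'a \<Rightarrow> 'f \<Rightarrow> real)) \<and>
    (\<forall>\<rho>. nash_equilibrium C e B (symmetric_profile \<rho> :: 'a \<Rightarrow> 'f \<Rightarrow> real) \<longrightarrow>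
      (\<exists>l\<ge>0. \<exists>\<nu>. (\<forall>f. \<nu> f = 0) \<and>
        (\<forall>(i::'a) f. marginal_payoff C e i f \<rho> = l - \<nu> f) \<and>
        l * ((\<Sum>f\<in>UNIV. \<rho> f) - B) = 0 \<and>
        (\<forall>f. \<nu> f * \<rho> f = 0)))"
proof -
  define m where "m = real CARD('a) - 1"
  have m: "m > 0" using assms(1) by (simp add: m_def)
  have nash: "nash_equilibrium C e B (symmetric_profile \<rho> :: 'a \<Rightarrow> 'f \<Rightarrow> real)
      \<longleftrightarrow> variational_solution m C e B \<rho>" for \<rho>
    unfolding nash_equilibrium_symmetric_iff m_def[symmetric]
    by (rule best_response_iff_variational_solution[OF m assms(2,3)])
  have ex1: "\<exists>!\<rho>. variational_solution m C e B \<rho>"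
    by (intro ex_ex1I variational_solution_exists variational_solution_unique[where m = m and C = C]
        m assms(2,3))
  have kkt: "\<exists>l\<ge>0. \<exists>\<nu>. (\<forall>f. \<nu> f = 0) \<and> (\<forall>(i::'a) f. marginal_payoff C e i f \<rho> = l - \<nu> f) \<and>
      l * ((\<Sum>f\<in>UNIV. \<rho> f) - B) = 0 \<and> (\<forall>f. \<nu> f * \<rho> f = 0)"
    if \<rho>: "variational_solution m C e B \<rho>" for \<rho>
  proof -
    obtain l where l: "l \<ge> 0" "\<forall>f. symmetric_marginal m C e \<rho> f = l" "l * (sum \<rho> UNIV - B) = 0"
      using variational_solution_multiplier[OF assms(3) \<rho>] by metis
    have "marginal_payoff C e i f \<rho> = l" for i :: 'a and f
    proof -
      have "\<rho> f > 0" using \<rho> by (simp add: variational_solution_def)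
      \<comment> \<open>Positivity identifies the derivative with its closed form, which is
        \<open>symmetric_marginal\<close> for \<open>m + 1\<close> players.\<close>
      from marginal_payoff_eq[where i = i and C = C and e = e and \<rho> = \<rho> and f = f, OF this] l(2) show ?thesis
        by (simp add: symmetric_marginal_def m_def)
    qed
    \<comment> \<open>The nonnegativity constraints are inactive at positive rates, hence the zero
      witness for \<open>\<nu>\<close>.\<close>
    then show ?thesis using l(1,3) by (intro exI[of _ l] conjI exI[of _ "\<lambda>_. 0"]) auto
  qed
  show ?thesis
    unfolding nash by (intro conjI ex1 allI impI kkt)
qed

end
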